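(* For all integers $k_1,k_2\ge 1$, the sum $\sum_{\mu} a_{k_1}(\mu)\, a_{k_2}(\mu)$ (over all integer partitions $\mu$) is the number of $(k_1,k_2)$-connecting set partitions of $[k_1+k_2]$.
   Context: $[k]=\{1,2,\dots,k\}$. Integer partitions are identified with their Young diagrams and ordered by containment; $\emptyset$ is the only partition of $0$. A limiting vacillating tableau of shape $\mu$ and length $2k$ is a sequence of integer partitions $(\mu^{(0)}=\emptyset,\mu^{(1/2)},\mu^{(1)},\dots,\mu^{(k-1/2)},\mu^{(k)}=\mu)$ such that for each integer $j=0,\dots,k-1$: (a) $\mu^{(j)}\supseteq\mu^{(j+1/2)}$ and $|\mu^{(j)}/\mu^{(j+1/2)}|\in\{0,1\}$; (b) $\mu^{(j+1/2)}\subseteq\mu^{(j+1)}$ and $|\mu^{(j+1)}/\mu^{(j+1/2)}|=1$. $a_k(\mu)$ is the number of limiting vacillating tableaux of shape $\mu$ and length $2k$. A set partition of $[k_1+k_2]$ is $(k_1,k_2)$-connecting if every block $X$ satisfies $\min X\le k_1<\max X$, or equivalently $X\cap[k_1]\neq\emptyset$ and $X\cap\{k_1+1,\dots,k_1+k_2\}\neq\emptyset$. *)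

theory Defs
  imports "HOL-Library.Disjoint_Sets" "HOL-Analysis.Infinite_Sum"
begin

definition int_partition :: "nat list \<Rightarrow> bool" where
  "int_partition \<mu> \<longleftrightarrow> sorted_wrt (\<ge>) \<mu> \<and> (\<forall>p \<in> set \<mu>. p > 0)"

definition young_diagram :: "nat list \<Rightarrow> (nat \<times> nat) set" where
  "young_diagram \<mu> = {(i, j). i < length \<mu> \<and> j < \<mu> ! i}"

text \<open>
  The entry of a tableau at the half-integer position \<open>j / 2\<close> is stored at list index \<open>j\<close>,
  so a tableau of length \<open>2 * k\<close> is a list with \<open>2 * k + 1\<close> entries. The size of a skew shape
  is the number of cells in the difference of the two diagrams.
\<close>

definition limiting_vacillating_tableau :: "nat \<Rightarrow> nat list \<Rightarrow> nat list list \<Rightarrow> bool" where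
  "limiting_vacillating_tableau k \<mu> T \<longleftrightarrow>
     length T = 2 * k + 1 \<and>
     (\<forall>\<nu> \<in> set T. int_partition \<nu>) \<and>
     T ! 0 = [] \<and> T ! (2 * k) = \<mu> \<and>
     (\<forall>j < k.
        young_diagram (T ! (2 * j + 1)) \<subseteq> young_diagram (T ! (2 * j)) \<and>
        card (young_diagram (T ! (2 * j)) - young_diagram (T ! (2 * j + 1))) \<in> {0, 1} \<and>
        young_diagram (T ! (2 * j + 1)) \<subseteq> young_diagram (T ! (2 * j + 2)) \<and>
        card (young_diagram (T ! (2 * j + 2)) - young_diagram (T ! (2 * j + 1))) = 1)"

definition num_lvt :: "nat \<Rightarrow> nat list \<Rightarrow> nat" where
  "num_lvt k \<mu> = card {T. limiting_vacillating_tableau k \<mu> T}"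

definition connecting_partition :: "nat \<Rightarrow> nat \<Rightarrow> nat set set \<Rightarrow> bool" where
  "connecting_partition k1 k2 P \<longleftrightarrow>
     partition_on {1..k1 + k2} P \<and> (\<forall>X \<in> P. Min X \<le> k1 \<and> k1 < Max X)"

end

theory Submission
  imports Defs "HOL-Combinatorics.Stirling"
begin

text \<open>
  Let \<open>U\<close> and \<open>\<partial>\<close> be the operators on formal sums of Young diagrams that add, respectively
  remove, one cell in all possible ways. Young's lattice is a differential poset:
  \<open>\<partial> U - U \<partial> = 1\<close> (\<open>up_down_commutation\<close>). A limiting vacillating tableau of length \<open>2 * k\<close> is a
  term of \<open>(U (1 + \<partial>))\<^sup>k \<emptyset>\<close>, and the commutation relation is all that is needed to evaluate this vector.

  Write \<open>f\<^sup>\<mu>\<close> for the number of saturated chains from \<open>\<emptyset>\<close> to \<open>\<mu>\<close> (standard Young tableaux of shape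
  \<open>\<mu>\<close>), so that \<open>U\<^sup>m \<emptyset>\<close> is the sum of all \<open>f\<^sup>\<mu> \<mu>\<close> with \<open>m\<close> cells. The commutation relation gives
  \<open>\<partial> (U\<^sup>m \<emptyset>) = m U\<^sup>m\<^sup>-\<^sup>1 \<emptyset>\<close>, hence \<open>U (1 + \<partial>)\<close> maps \<open>U\<^sup>m \<emptyset>\<close> to \<open>U\<^sup>m\<^sup>+\<^sup>1 \<emptyset> + m U\<^sup>m \<emptyset>\<close>. This is the recurrence
  of the Stirling numbers of the second kind, so \<open>a\<^sub>k(\<mu>) = S(k, m) f\<^sup>\<mu>\<close> for \<open>\<mu>\<close> with \<open>m\<close> cells
  (\<open>num_walks_eq\<close>). The same relation yields the classical identity that the squares of \<open>f\<^sup>\<mu>\<close> over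
  the diagrams with \<open>m\<close> cells sum to \<open>m!\<close> (\<open>sum_num_chains_squared\<close>). Therefore the sum in the
  theorem equals the sum over \<open>m\<close> of \<open>S(k\<^sub>1, m) S(k\<^sub>2, m) m!\<close> (\<open>has_sum_num_lvt_product\<close>).

  The same number counts connecting partitions (\<open>card_meeting_partitions\<close>): each of them is obtained
  in exactly one way from a partition of \<open>[k\<^sub>1]\<close> into \<open>m\<close> blocks, of which there are \<open>S(k\<^sub>1, m)\<close>,
  by attaching every element of the other part to one of these blocks so that each block receives
  at least one element. The attachments are the \<open>m! S(k\<^sub>2, m)\<close> surjections onto the set of blocks.
\<close>

section \<open>Young's lattice as a differential poset\<close>

text \<open>
  Partitions are handled through their diagrams, the finite order ideals of \<open>\<nat> \<times> \<nat>\<close>, because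
  joins and meets of Young's lattice are then unions and intersections.
\<close>

definition is_diagram :: "(nat \<times> nat) set \<Rightarrow> bool" where
  "is_diagram D \<longleftrightarrow> finite D \<and> (\<forall>i j i' j'. (i, j) \<in> D \<longrightarrow> i' \<le> i \<longrightarrow> j' \<le> j \<longrightarrow> (i', j') \<in> D)"

definition up_covers :: "(nat \<times> nat) set \<Rightarrow> (nat \<times> nat) set set" where
  "up_covers D = {E. is_diagram E \<and> D \<subseteq> E \<and> card (E - D) = 1}"

definition down_covers :: "(nat \<times> nat) set \<Rightarrow> (nat \<times> nat) set set" where
  "down_covers E = {D. is_diagram D \<and> D \<subseteq> E \<and> card (E - D) = 1}"

definition row_length :: "(nat \<times> nat) set \<Rightarrow> nat \<Rightarrow> nat" where
  "row_length D i = card {j. (i, j) \<in> D}"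

lemma is_diagramD: "is_diagram D \<Longrightarrow> (i, j) \<in> D \<Longrightarrow> i' \<le> i \<Longrightarrow> j' \<le> j \<Longrightarrow> (i', j') \<in> D"
  unfolding is_diagram_def by blast

lemma is_diagram_finite: "is_diagram D \<Longrightarrow> finite D"
  unfolding is_diagram_def by blast

lemma finite_down_closed_nat:
  fixes S :: "nat set"
  assumes "finite S" and "\<And>j j'. j \<in> S \<Longrightarrow> j' \<le> j \<Longrightarrow> j' \<in> S"
  shows "S = {..<card S}"
proof (cases "S = {}")
  case False
  then have "Max S \<in> S"
    using assms(1) by simp
  then have "{..Max S} \<subseteq> S"
    using assms(2) by blast
  moreover have "S \<subseteq> {..Max S}"
    using assms(1) by auto
  ultimately have "S = {..Max S}"
    by simp
  then show ?thesis
    by (metis card_atMost lessThan_Suc_atMost)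
qed simp

lemma mem_diagram_iff: "is_diagram D \<Longrightarrow> (i, j) \<in> D \<longleftrightarrow> j < row_length D i"
proof -
  assume D: "is_diagram D"
  have "finite {j. (i, j) \<in> D}"
    using finite_vimageI[OF is_diagram_finite[OF D], of "Pair i"] by (simp add: vimage_def inj_on_def)
  then have "{j. (i, j) \<in> D} = {..<row_length D i}"
    unfolding row_length_def by (rule finite_down_closed_nat) (use is_diagramD[OF D] in blast)
  then show ?thesis
    by auto
qed

lemma row_length_antimono: "is_diagram D \<Longrightarrow> i \<le> i' \<Longrightarrow> row_length D i' \<le> row_length D i"
proof -
  assume D: "is_diagram D" and le: "i \<le> i'"
  have "j < row_length D i" if "j < row_length D i'" for j
    using that is_diagramD[OF D, of i' j i j] le by (simp add: mem_diagram_iff[OF D])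
  then show ?thesis
    by (meson leI less_irrefl)
qed

text \<open>
  A cell \<open>(i, j)\<close> forces \<open>i + 1\<close> cells in its column and \<open>j + 1\<close> cells in its row. The bound is
  crude, but it shows that there are finitely many diagrams of each size.
\<close>

lemma is_diagram_subset_square:
  assumes "is_diagram D"
  shows "D \<subseteq> {..<card D} \<times> {..<card D}"
proof clarify
  fix i j assume ij: "(i, j) \<in> D"
  have "card ((\<lambda>i'. (i', j)) ` {..i}) \<le> card D"
    by (rule card_mono) (use is_diagramD[OF assms ij] is_diagram_finite[OF assms] in auto)
  moreover have "card (Pair i ` {..j}) \<le> card D"
    by (rule card_mono) (use is_diagramD[OF assms ij] is_diagram_finite[OF assms] in auto)
  ultimately show "i \<in> {..<card D} \<and> j \<in> {..<card D}"
    by (simp add: card_image inj_on_def)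
qed

lemma finite_diagrams_of_card: "finite {D. is_diagram D \<and> card D = n}"
  by (rule finite_subset[of _ "Pow ({..<n} \<times> {..<n})"]) (use is_diagram_subset_square in auto)

lemma card_Diff_eq_1_iff:
  "D \<subseteq> E \<and> card (E - D) = 1 \<longleftrightarrow> (\<exists>c. c \<notin> D \<and> E = insert c D)"
proof
  assume "D \<subseteq> E \<and> card (E - D) = 1"
  then show "\<exists>c. c \<notin> D \<and> E = insert c D"
    by (auto simp: card_1_singleton_iff)
qed (auto simp: insert_Diff_if)

lemma up_covers_iff: "E \<in> up_covers D \<longleftrightarrow> is_diagram E \<and> (\<exists>c. c \<notin> D \<and> E = insert c D)"
  unfolding up_covers_def using card_Diff_eq_1_iff[of D E] by blast

lemma down_covers_iff: "D \<in> down_covers E \<longleftrightarrow> is_diagram D \<and> (\<exists>c. c \<notin> D \<and> E = insert c D)"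
  unfolding down_covers_def using card_Diff_eq_1_iff[of D E] by blast

lemma card_up_covers_elem: "is_diagram D \<Longrightarrow> E \<in> up_covers D \<Longrightarrow> card E = Suc (card D)"
  by (auto simp: up_covers_iff is_diagram_finite)

lemma card_down_covers_elem: "D \<in> down_covers E \<Longrightarrow> card E = Suc (card D)"
  by (auto simp: down_covers_iff is_diagram_finite)

lemma finite_up_covers: "is_diagram D \<Longrightarrow> finite (up_covers D)"
  by (rule finite_subset[OF _ finite_diagrams_of_card[of "Suc (card D)"]])
     (use card_up_covers_elem in \<open>auto simp: up_covers_iff\<close>)

lemma finite_down_covers: "is_diagram E \<Longrightarrow> finite (down_covers E)"
  by (rule finite_subset[of _ "Pow E"]) (auto simp: down_covers_iff is_diagram_finite)

lemma is_diagram_Int: "is_diagram D \<Longrightarrow> is_diagram E \<Longrightarrow> is_diagram (D \<inter> E)"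
  unfolding is_diagram_def by blast

lemma is_diagram_Un: "is_diagram D \<Longrightarrow> is_diagram E \<Longrightarrow> is_diagram (D \<union> E)"
  unfolding is_diagram_def by blast

text \<open>
  A cell can only be added at the end of a row. This is possible in the topmost row, and in any
  other row exactly when it is strictly shorter than the row above it. Together with
  \<open>down_covers_bij_rows\<close> this shows that the addable rows are row \<open>0\<close> and the successors of the
  removable rows.
\<close>

lemma up_covers_bij_rows:
  assumes D: "is_diagram D"
  shows "bij_betw (\<lambda>i. insert (i, row_length D i) D)
           (insert 0 (Suc ` {i. row_length D (Suc i) < row_length D i})) (up_covers D)"
    (is "bij_betw ?h ?I _")
proof (rule bij_betw_imageI)
  have new: "(i, row_length D i) \<notin> D" for i
    using mem_diagram_iff[OF D] by blast
  show "inj_on ?h ?I"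
    using new by (intro inj_onI) (metis insertE insertI1 prod.inject)
  show "?h ` ?I = up_covers D"
  proof (intro equalityI subsetI)
    fix E assume "E \<in> ?h ` ?I"
    then obtain i where E: "E = ?h i" and i: "i = 0 \<or> (\<exists>k. i = Suc k \<and> row_length D i < row_length D k)"
      by blast
    have "(i', j') \<in> E" if i': "i' \<le> i" and j': "j' \<le> row_length D i" for i' j'
    proof (cases "i' = i")
      case True
      then show ?thesis
        using that mem_diagram_iff[OF D, of i j'] by (auto simp: E)
    next
      case False
      then obtain k where k: "i = Suc k" "row_length D i < row_length D k" "i' \<le> k"
        using i i' by (cases i) auto
      then have "j' < row_length D i'"
        using row_length_antimono[OF D k(3)] k(2) j' by linarith
      then show ?thesis
        using mem_diagram_iff[OF D] by (simp add: E)
    qed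
    then have "is_diagram E"
      using D unfolding is_diagram_def E by blast
    then show "E \<in> up_covers D"
      using new E by (auto simp: up_covers_iff)
  next
    fix E assume "E \<in> up_covers D"
    then obtain i j where E: "is_diagram E" "E = insert (i, j) D" "(i, j) \<notin> D"
      by (auto simp: up_covers_iff)
    have le: "row_length D i \<le> j"
      using E(3) mem_diagram_iff[OF D] by (simp add: not_less)
    have "(i, j') \<in> D" if "j' < j" for j'
      using is_diagramD[OF E(1), of i j i j'] that E(2) by auto
    then have "j \<le> row_length D i"
      using mem_diagram_iff[OF D] by (metis leI less_irrefl)
    with le have j: "j = row_length D i"
      by simp
    have "row_length D (Suc k) < row_length D k" if "i = Suc k" for k
    proof -
      have "(k, j) \<in> D"
        using is_diagramD[OF E(1), of i j k j] that E(2) by auto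
      then show ?thesis
        using mem_diagram_iff[OF D] j that by simp
    qed
    then have "i \<in> ?I"
      by (cases i) auto
    then show "E \<in> ?h ` ?I"
      using E(2) j by blast
  qed
qed

lemma down_covers_bij_rows:
  assumes D: "is_diagram D"
  shows "bij_betw (\<lambda>i. D - {(i, row_length D i - 1)})
           {i. row_length D (Suc i) < row_length D i} (down_covers D)"
    (is "bij_betw ?h ?I _")
proof (rule bij_betw_imageI)
  have last: "(i, row_length D i - 1) \<in> D" if "i \<in> ?I" for i
    using mem_diagram_iff[OF D] that by simp
  show "inj_on ?h ?I"
    using last by (fastforce simp: inj_on_def)
  show "?h ` ?I = down_covers D"
  proof (intro equalityI subsetI)
    fix E assume "E \<in> ?h ` ?I"
    then obtain i where E: "E = ?h i" and i: "row_length D (Suc i) < row_length D i"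
      by blast
    have "i' = i \<and> j' = row_length D i - 1"
      if "(i', j') \<in> D" "i \<le> i'" "row_length D i - 1 \<le> j'" for i' j'
    proof -
      have j': "j' < row_length D i'"
        using that(1) mem_diagram_iff[OF D] by simp
      have "\<not> Suc i \<le> i'"
        using row_length_antimono[OF D, of "Suc i" i'] j' that(3) i by linarith
      then have "i' = i"
        using that(2) by simp
      with that(3) j' show ?thesis
        by auto
    qed
    then have "is_diagram E"
      using D unfolding is_diagram_def E by (metis Diff_iff finite_Diff insert_iff empty_iff prod.inject)
    then show "E \<in> down_covers D"
      using last[of i] i E by (auto simp: down_covers_iff)
  next
    fix E assume "E \<in> down_covers D"
    then obtain i j where E: "is_diagram E" "D = insert (i, j) E" "(i, j) \<notin> E"
      by (auto simp: down_covers_iff)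
    have lt: "j < row_length D i"
      using E(2) mem_diagram_iff[OF D] by blast
    have right: "(i, Suc j) \<notin> D" and below: "(Suc i, j) \<notin> D"
      using is_diagramD[OF E(1), of i "Suc j" i j] is_diagramD[OF E(1), of "Suc i" j i j] E by auto
    have j: "j = row_length D i - 1"
      using right lt mem_diagram_iff[OF D] by fastforce
    have "row_length D (Suc i) < row_length D i"
      using below lt mem_diagram_iff[OF D] by fastforce
    moreover have "E = D - {(i, j)}"
      using E(2,3) by auto
    then have "E = ?h i"
      by (simp only: j)
    ultimately show "E \<in> ?h ` ?I"
      by blast
  qed
qed

text \<open>
  The surplus of one is the topmost row. This is the diagonal part of \<open>\<partial> U - U \<partial> = 1\<close>.
\<close>

lemma card_up_covers:
  assumes D: "is_diagram D"
  shows "card (up_covers D) = Suc (card (down_covers D))"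
proof -
  let ?R = "{i. row_length D (Suc i) < row_length D i}"
  have "finite ?R"
    using down_covers_bij_rows[OF D] finite_down_covers[OF D] bij_betw_finite by blast
  then have "card (insert 0 (Suc ` ?R)) = Suc (card ?R)"
    by (simp add: card_image)
  then show ?thesis
    using bij_betw_same_card[OF up_covers_bij_rows[OF D]]
          bij_betw_same_card[OF down_covers_bij_rows[OF D]] by simp
qed

text \<open>
  For distinct \<open>D\<close> and \<open>C\<close>, a common upper cover yields the common lower cover \<open>D \<inter> C\<close>: the cell
  that is added to one of them is the cell that is removed from the other.
\<close>

lemma insert_pair_Un_Int:
  assumes "insert c D = insert d C" "c \<notin> D" "d \<notin> C" "C \<noteq> D"
  shows "c \<notin> D \<inter> C \<and> d \<notin> D \<inter> C \<and> C = insert c (D \<inter> C) \<and> D = insert d (D \<inter> C)"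
proof -
  have "c \<noteq> d"
    using assms by auto
  then have "c \<in> C" "d \<in> D"
    using assms(1) by auto
  then show ?thesis
    using assms by auto
qed

text \<open>
  The relation \<open>\<partial> U = U \<partial> + 1\<close>, tested against an arbitrary weight \<open>g\<close>. The walks that go up from
  \<open>D\<close> and down to a different \<open>C\<close> correspond to those that go down and then up, since the middle
  vertex is forced to be \<open>D \<union> C\<close>, respectively \<open>D \<inter> C\<close>. The walks that return to \<open>D\<close> are counted by
  \<open>card_up_covers\<close> and leave a surplus of one.
\<close>

lemma up_down_commutation:
  fixes g :: "(nat \<times> nat) set \<Rightarrow> nat"
  assumes D: "is_diagram D"
  shows "(\<Sum>E\<in>up_covers D. \<Sum>C\<in>down_covers E. g C) =
         g D + (\<Sum>B\<in>down_covers D. \<Sum>C\<in>up_covers B. g C)"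
proof -
  have fin: "finite (down_covers E)" if "E \<in> up_covers D" for E
    using that finite_down_covers by (auto simp: up_covers_iff)
  have fin': "finite (up_covers B)" if "B \<in> down_covers D" for B
    using that finite_up_covers by (auto simp: down_covers_iff)
  have "(\<Sum>E\<in>up_covers D. \<Sum>C\<in>down_covers E. g C)
      = (\<Sum>E\<in>up_covers D. g D + (\<Sum>C\<in>down_covers E - {D}. g C))"
  proof (rule sum.cong[OF refl])
    fix E assume E: "E \<in> up_covers D"
    then have "D \<in> down_covers E"
      using D by (auto simp: up_covers_iff down_covers_iff)
    then show "(\<Sum>C\<in>down_covers E. g C) = g D + (\<Sum>C\<in>down_covers E - {D}. g C)"
      using fin[OF E] by (simp add: sum.remove)
  qed
  also have "\<dots> = card (up_covers D) * g D + (\<Sum>E\<in>up_covers D. \<Sum>C\<in>down_covers E - {D}. g C)"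
    by (simp add: sum.distrib)
  also have "(\<Sum>E\<in>up_covers D. \<Sum>C\<in>down_covers E - {D}. g C)
      = (\<Sum>B\<in>down_covers D. \<Sum>C\<in>up_covers B - {D}. g C)"
  proof -
    have "(\<Sum>(E, C)\<in>(SIGMA E:up_covers D. down_covers E - {D}). g C)
        = (\<Sum>(B, C)\<in>(SIGMA B:down_covers D. up_covers B - {D}). g C)"
    proof (rule sum.reindex_bij_witness[where i = "\<lambda>(B, C). (D \<union> C, C)" and j = "\<lambda>(E, C). (D \<inter> C, C)"])
      fix p assume "p \<in> (SIGMA E:up_covers D. down_covers E - {D})"
      then obtain E C where EC: "p = (E, C)" "E \<in> up_covers D" "C \<in> down_covers E" "C \<noteq> D"
        by blast
      obtain c where c: "c \<notin> D" "E = insert c D"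
        using EC(2) unfolding up_covers_iff by blast
      obtain d where d: "is_diagram C" "d \<notin> C" "E = insert d C"
        using EC(3) unfolding down_covers_iff by blast
      have cd: "c \<notin> D \<inter> C \<and> d \<notin> D \<inter> C \<and> C = insert c (D \<inter> C) \<and> D = insert d (D \<inter> C)"
        by (rule insert_pair_Un_Int) (use c d EC(4) in auto)
      have "D \<union> C = E"
        using c(2) cd by blast
      then show "(case case p of (E, C) \<Rightarrow> (D \<inter> C, C) of (B, C) \<Rightarrow> (D \<union> C, C)) = p"
        by (simp add: EC(1))
      have "D \<inter> C \<in> down_covers D"
        unfolding down_covers_iff using is_diagram_Int[OF D d(1)] cd by blast
      moreover have "C \<in> up_covers (D \<inter> C)"
        unfolding up_covers_iff using d(1) cd by blast
      ultimately show "(case p of (E, C) \<Rightarrow> (D \<inter> C, C)) \<in> (SIGMA B:down_covers D. up_covers B - {D})"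
        using EC(4) by (simp add: EC(1))
      show "(case case p of (E, C) \<Rightarrow> (D \<inter> C, C) of (B, C) \<Rightarrow> g C) = (case p of (E, C) \<Rightarrow> g C)"
        by (simp add: EC(1))
    next
      fix p assume "p \<in> (SIGMA B:down_covers D. up_covers B - {D})"
      then obtain B C where BC: "p = (B, C)" "B \<in> down_covers D" "C \<in> up_covers B" "C \<noteq> D"
        by blast
      obtain c where c: "is_diagram C" "c \<notin> B" "C = insert c B"
        using BC(3) unfolding up_covers_iff by blast
      obtain d where d: "d \<notin> B" "D = insert d B"
        using BC(2) unfolding down_covers_iff by blast
      have "c \<noteq> d"
        using c d BC(4) by auto
      then have "D \<inter> C = B"
        using c d by auto
      then
      show "(case case p of (B, C) \<Rightarrow> (D \<union> C, C) of (E, C) \<Rightarrow> (D \<inter> C, C)) = p"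
        by (simp add: BC(1))
      have "D \<union> C = insert c D" "D \<union> C = insert d C" "c \<notin> D" "d \<notin> C"
        using c d \<open>c \<noteq> d\<close> by auto
      then have "D \<union> C \<in> up_covers D" "C \<in> down_covers (D \<union> C)"
        unfolding up_covers_iff down_covers_iff using is_diagram_Un[OF D c(1)] c(1) by blast+
      then show "(case p of (B, C) \<Rightarrow> (D \<union> C, C)) \<in> (SIGMA E:up_covers D. down_covers E - {D})"
        using BC(4) by (simp add: BC(1))
    qed
    then show ?thesis
      using finite_up_covers[OF D] finite_down_covers[OF D] fin fin' by (simp add: sum.Sigma)
  qed
  also have "card (up_covers D) * g D + \<dots>
      = g D + (\<Sum>B\<in>down_covers D. g D + (\<Sum>C\<in>up_covers B - {D}. g C))"
    by (simp add: sum.distrib card_up_covers[OF D])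
  also have "\<dots> = g D + (\<Sum>B\<in>down_covers D. \<Sum>C\<in>up_covers B. g C)"
  proof -
    have "g D + (\<Sum>C\<in>up_covers B - {D}. g C) = (\<Sum>C\<in>up_covers B. g C)" if B: "B \<in> down_covers D" for B
    proof -
      have "D \<in> up_covers B"
        using D B by (auto simp: up_covers_iff down_covers_iff)
      then show ?thesis
        using fin'[OF B] by (simp add: sum.remove)
    qed
    then show ?thesis
      by simp
  qed
  finally show ?thesis .
qed

section \<open>Counting chains in Young's lattice\<close>

text \<open>
  The number of chains \<open>\<emptyset> = D\<^sub>0, D\<^sub>1, \<dots>, D\<^sub>n = D\<close> in which each step adds one cell. For \<open>n = card D\<close>
  it is the number of standard Young tableaux of shape \<open>D\<close>; for other \<open>n\<close> it vanishes.
\<close>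

fun num_chains :: "nat \<Rightarrow> (nat \<times> nat) set \<Rightarrow> nat" where
  "num_chains 0 D = (if D = {} then 1 else 0)"
| "num_chains (Suc n) D = (\<Sum>C\<in>down_covers D. num_chains n C)"

text \<open>
  The coefficient of \<open>D\<close> in \<open>(U (1 + \<partial>))\<^sup>k \<emptyset>\<close>. Reading a tableau backwards, the last step adds a cell
  to some \<open>C\<close>, and the step before it either stays at \<open>C\<close> or removes a cell from some \<open>E\<close>.
\<close>

fun num_walks :: "nat \<Rightarrow> (nat \<times> nat) set \<Rightarrow> nat" where
  "num_walks 0 D = (if D = {} then 1 else 0)"
| "num_walks (Suc k) D =
     (\<Sum>C\<in>down_covers D. num_walks k C + (\<Sum>E\<in>up_covers C. num_walks k E))"

text \<open>
  This is \<open>\<partial> (U\<^sup>n\<^sup>+\<^sup>1 \<emptyset>) = (n + 1) U\<^sup>n \<emptyset>\<close>: moving the down operator to the right past one up operator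
  yields one extra copy of \<open>U\<^sup>n \<emptyset>\<close> each time, and it annihilates \<open>\<emptyset>\<close>.
\<close>

lemma sum_num_chains_up_covers:
  "is_diagram D \<Longrightarrow> (\<Sum>E\<in>up_covers D. num_chains (Suc n) E) = Suc n * num_chains n D"
proof (induction n arbitrary: D)
  case 0
  have "(\<Sum>B\<in>down_covers D. \<Sum>C\<in>up_covers B. num_chains 0 C) = 0"
    by (auto simp: up_covers_iff intro!: sum.neutral)
  then show ?case
    using up_down_commutation[OF 0, of "num_chains 0"] by simp
next
  case (Suc n)
  have "(\<Sum>B\<in>down_covers D. \<Sum>C\<in>up_covers B. num_chains (Suc n) C)
      = (\<Sum>B\<in>down_covers D. Suc n * num_chains n B)"
    by (rule sum.cong[OF refl], rule Suc.IH) (simp add: down_covers_iff)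
  also have "\<dots> = Suc n * num_chains (Suc n) D"
    by (simp only: num_chains.simps sum_distrib_left)
  finally show ?case
    using up_down_commutation[OF Suc.prems, of "num_chains (Suc n)"] by simp
qed

text \<open>
  In one step \<open>U (1 + \<partial>)\<close> the diagrams with \<open>m + 1\<close> cells receive \<open>S(k, m)\<close> from the stationary
  half-step and \<open>(m + 1) S(k, m + 1)\<close> from the removal of a cell, each times \<open>f\<close>.
\<close>

lemma num_walks_eq:
  "is_diagram D \<Longrightarrow> num_walks k D = Stirling k (card D) * num_chains (card D) D"
proof (induction k arbitrary: D)
  case 0
  then show ?case
    by (cases "card D") (auto simp: is_diagram_finite)
next
  case (Suc k)
  show ?case
  proof (cases "card D")
    case 0
    then show ?thesis
      using card_down_covers_elem[of _ D] by (auto intro!: sum.neutral)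
  next
    case (Suc m)
    have "num_walks k C + (\<Sum>E\<in>up_covers C. num_walks k E) = Stirling (Suc k) (Suc m) * num_chains m C"
      if C: "C \<in> down_covers D" for C
    proof -
      have dC: "is_diagram C" and mC: "card C = m"
        using C card_down_covers_elem[OF C] Suc by (auto simp: down_covers_iff)
      have "(\<Sum>E\<in>up_covers C. num_walks k E) = (\<Sum>E\<in>up_covers C. Stirling k (Suc m) * num_chains (Suc m) E)"
        using Suc.IH card_up_covers_elem[OF dC] mC
        by (intro sum.cong refl) (simp add: up_covers_iff del: num_chains.simps)
      also have "\<dots> = Stirling k (Suc m) * (Suc m * num_chains m C)"
        using sum_num_chains_up_covers[OF dC, of m] by (simp only: sum_distrib_left[symmetric])
      finally show ?thesis
        using Suc.IH[OF dC] mC by (simp add: algebra_simps)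
    qed
    then show ?thesis
      unfolding Suc by (simp add: sum_distrib_left del: Stirling.simps)
  qed
qed

text \<open>
  Expanding one of the two factors along the lower covers and exchanging the sums reduces the
  claim for \<open>n + 1\<close> to \<open>sum_num_chains_up_covers\<close>, which contributes the factor \<open>n + 1\<close>.
\<close>

lemma sum_num_chains_squared:
  "(\<Sum>D | is_diagram D \<and> card D = n. num_chains n D * num_chains n D) = fact n"
proof (induction n)
  case 0
  have "{D. is_diagram D \<and> card D = 0} = {{}}"
    by (auto simp: is_diagram_def)
  then show ?case
    by simp
next
  case (Suc n)
  let ?Y = "\<lambda>n. {D. is_diagram D \<and> card D = n}"
  have "(\<Sum>D\<in>?Y (Suc n). num_chains (Suc n) D * num_chains (Suc n) D)
      = (\<Sum>D\<in>?Y (Suc n). \<Sum>C | C \<in> ?Y n \<and> C \<in> down_covers D. num_chains (Suc n) D * num_chains n C)"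
  proof (rule sum.cong[OF refl])
    fix D assume "D \<in> ?Y (Suc n)"
    then have "{C. C \<in> ?Y n \<and> C \<in> down_covers D} = down_covers D"
      using card_down_covers_elem[of _ D] by (fastforce simp: down_covers_def)
    then show "num_chains (Suc n) D * num_chains (Suc n) D
      = (\<Sum>C | C \<in> ?Y n \<and> C \<in> down_covers D. num_chains (Suc n) D * num_chains n C)"
      by (simp add: sum_distrib_left)
  qed
  also have "\<dots> = (\<Sum>C\<in>?Y n. \<Sum>D | D \<in> ?Y (Suc n) \<and> C \<in> down_covers D. num_chains (Suc n) D * num_chains n C)"
    by (rule sum.swap_restrict) (rule finite_diagrams_of_card)+
  also have "\<dots> = (\<Sum>C\<in>?Y n. Suc n * (num_chains n C * num_chains n C))"
  proof (rule sum.cong[OF refl])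
    fix C assume C: "C \<in> ?Y n"
    then have "{D. D \<in> ?Y (Suc n) \<and> C \<in> down_covers D} = up_covers C"
      using card_up_covers_elem[of C] by (auto simp: down_covers_def up_covers_def)
    then have "(\<Sum>D | D \<in> ?Y (Suc n) \<and> C \<in> down_covers D. num_chains (Suc n) D * num_chains n C)
        = (\<Sum>D\<in>up_covers C. num_chains (Suc n) D) * num_chains n C"
      by (simp only: sum_distrib_right)
    then show "(\<Sum>D | D \<in> ?Y (Suc n) \<and> C \<in> down_covers D. num_chains (Suc n) D * num_chains n C)
        = Suc n * (num_chains n C * num_chains n C)"
      using sum_num_chains_up_covers[of C n] C by (simp only: mem_Collect_eq mult.assoc)
  qed
  also have "\<dots> = fact (Suc n)"
    using Suc.IH by (simp only: sum_distrib_left[symmetric] fact_Suc of_nat_id)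
  finally show ?case .
qed

section \<open>Integer partitions and limiting vacillating tableaux\<close>

lemma int_partition_nth_antimono:
  "int_partition \<mu> \<Longrightarrow> i' \<le> i \<Longrightarrow> i < length \<mu> \<Longrightarrow> \<mu> ! i \<le> \<mu> ! i'"
  unfolding int_partition_def by (metis le_eq_less_or_eq order.refl sorted_wrt_nth_less)

lemma is_diagram_young_diagram:
  assumes "int_partition \<mu>"
  shows "is_diagram (young_diagram \<mu>)"
  unfolding is_diagram_def
proof (intro conjI allI impI)
  have "young_diagram \<mu> = (SIGMA i:{..<length \<mu>}. {..<\<mu> ! i})"
    by (auto simp: young_diagram_def)
  then show "finite (young_diagram \<mu>)"
    by simp
  fix i j i' j' assume "(i, j) \<in> young_diagram \<mu>" "i' \<le> i" "j' \<le> j"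
  then show "(i', j') \<in> young_diagram \<mu>"
    using int_partition_nth_antimono[OF assms, of i' i] by (auto simp: young_diagram_def)
qed

text \<open>
  The parts of a partition are the row lengths of its diagram, and as they are positive, the number
  of parts is the length of the first column. Both can be read off the diagram.
\<close>

lemma bij_young_diagram: "bij_betw young_diagram {\<mu>. int_partition \<mu>} {D. is_diagram D}"
proof (rule bij_betw_imageI)
  show "inj_on young_diagram {\<mu>. int_partition \<mu>}"
  proof (rule inj_onI; clarify)
    fix \<mu> \<nu> assume \<mu>: "int_partition \<mu>" and \<nu>: "int_partition \<nu>"
      and eq: "young_diagram \<mu> = young_diagram \<nu>"
    have iff: "i < length \<mu> \<and> j < \<mu> ! i \<longleftrightarrow> i < length \<nu> \<and> j < \<nu> ! i" for i j
      using eq by (auto simp: young_diagram_def set_eq_iff)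
    have "0 < \<mu> ! i" if "i < length \<mu>" for i
      using \<mu> that by (auto simp: int_partition_def)
    moreover have "0 < \<nu> ! i" if "i < length \<nu>" for i
      using \<nu> that by (auto simp: int_partition_def)
    ultimately have len: "i < length \<mu> \<longleftrightarrow> i < length \<nu>" for i
      using iff[of i 0] by blast
    then have "length \<mu> = length \<nu>"
      by (metis less_irrefl nat_neq_iff)
    then show "\<mu> = \<nu>"
      using iff by (intro nth_equalityI) (auto, metis nat_neq_iff less_irrefl)
  qed
  show "young_diagram ` {\<mu>. int_partition \<mu>} = {D. is_diagram D}"
  proof (intro equalityI subsetI)
    fix D assume "D \<in> {D. is_diagram D}"
    then have D: "is_diagram D"
      by simp
    define n where "n = card {i. (i, 0) \<in> D}"
    define \<mu> where "\<mu> = map (row_length D) [0..<n]"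
    have "finite {i. (i, 0::nat) \<in> D}"
      using finite_vimageI[OF is_diagram_finite[OF D], of "\<lambda>i. (i, 0)"]
      by (simp add: vimage_def inj_on_def)
    then have "{i. (i, 0) \<in> D} = {..<n}"
      unfolding n_def by (rule finite_down_closed_nat) (use is_diagramD[OF D] in blast)
    then have n: "(i, 0) \<in> D \<longleftrightarrow> i < n" for i
      by blast
    have "int_partition \<mu>"
      unfolding int_partition_def \<mu>_def
      using row_length_antimono[OF D] n mem_diagram_iff[OF D]
      by (auto simp: sorted_wrt_iff_nth_less)
    moreover have "young_diagram \<mu> = D"
    proof -
      have "(i, j) \<in> young_diagram \<mu> \<longleftrightarrow> (i, j) \<in> D" for i j
        using n[of i] is_diagramD[OF D, of i j i 0] mem_diagram_iff[OF D, of i j]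
        by (auto simp: young_diagram_def \<mu>_def)
      then show ?thesis
        by auto
    qed
    ultimately show "D \<in> young_diagram ` {\<mu>. int_partition \<mu>}"
      by blast
  qed (use is_diagram_young_diagram in auto)
qed

lemma sum_over_diagrams:
  assumes "S \<subseteq> {D. is_diagram D}"
  shows "(\<Sum>\<mu> | int_partition \<mu> \<and> young_diagram \<mu> \<in> S. g (young_diagram \<mu>)) = sum g S"
    and "finite S \<Longrightarrow> finite {\<mu>. int_partition \<mu> \<and> young_diagram \<mu> \<in> S}"
proof -
  have bij: "bij_betw young_diagram {\<mu>. int_partition \<mu> \<and> young_diagram \<mu> \<in> S} S"
  proof (rule bij_betw_subset[OF bij_young_diagram])
    show "young_diagram ` {\<mu>. int_partition \<mu> \<and> young_diagram \<mu> \<in> S} = S"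
    proof (intro equalityI subsetI)
      fix D assume "D \<in> S"
      then have "D \<in> young_diagram ` {\<mu>. int_partition \<mu>}"
        using assms bij_betw_imp_surj_on[OF bij_young_diagram] by auto
      then show "D \<in> young_diagram ` {\<mu>. int_partition \<mu> \<and> young_diagram \<mu> \<in> S}"
        using \<open>D \<in> S\<close> by auto
    qed auto
  qed auto
  show "(\<Sum>\<mu> | int_partition \<mu> \<and> young_diagram \<mu> \<in> S. g (young_diagram \<mu>)) = sum g S"
    using sum.reindex_bij_betw[OF bij] .
  show "finite S \<Longrightarrow> finite {\<mu>. int_partition \<mu> \<and> young_diagram \<mu> \<in> S}"
    using bij_betw_finite[OF bij] by blast
qed

text \<open>
  Appending the last two entries to a tableau of length \<open>2 * k\<close> and arbitrary shape \<open>\<kappa>\<close>. A difference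
  of zero cells between diagrams means equal partitions, which splits the weak half-step into the
  summands \<open>1\<close> and \<open>\<partial>\<close> of \<open>1 + \<partial>\<close>.
\<close>

lemma tableau_extend_iff:
  assumes "length S = 2 * k + 1"
  shows "limiting_vacillating_tableau (Suc k) \<mu> (S @ [\<rho>, \<nu>]) \<longleftrightarrow>
    (\<exists>\<kappa>. limiting_vacillating_tableau k \<kappa> S \<and> int_partition \<rho> \<and> int_partition \<nu> \<and> \<nu> = \<mu> \<and>
       young_diagram \<rho> \<in> down_covers (young_diagram \<nu>) \<and>
       (\<kappa> = \<rho> \<or> young_diagram \<kappa> \<in> up_covers (young_diagram \<rho>)))"
    (is "?L \<longleftrightarrow> ?R")
proof -
  let ?T = "S @ [\<rho>, \<nu>]" and ?Y = young_diagram
  have nth: "?T ! j = S ! j" if "j \<le> 2 * k" for j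
    using assms that by (simp add: nth_append)
  have last: "?T ! (2 * k + 1) = \<rho>" "?T ! (2 * k + 2) = \<nu>"
    using assms by (simp_all add: nth_append)
  have mem: "S ! (2 * k) \<in> set S"
    using assms by simp
  have skew: "?Y \<rho> \<subseteq> ?Y \<kappa> \<and> card (?Y \<kappa> - ?Y \<rho>) \<in> {0, 1} \<longleftrightarrow>
      \<kappa> = \<rho> \<or> ?Y \<kappa> \<in> up_covers (?Y \<rho>)"
    if \<kappa>: "int_partition \<kappa>" and \<rho>: "int_partition \<rho>" for \<kappa>
  proof -
    have "?Y \<rho> \<subseteq> ?Y \<kappa> \<and> card (?Y \<kappa> - ?Y \<rho>) = 0 \<longleftrightarrow> ?Y \<kappa> = ?Y \<rho>"
      using is_diagram_finite[OF is_diagram_young_diagram[OF \<kappa>]] by auto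
    also have "\<dots> \<longleftrightarrow> \<kappa> = \<rho>"
      using bij_betw_imp_inj_on[OF bij_young_diagram] \<kappa> \<rho> by (auto dest: inj_onD)
    finally show ?thesis
      unfolding up_covers_def using is_diagram_young_diagram[OF \<kappa>] by auto
  qed
  have down: "?Y \<rho> \<in> down_covers (?Y \<nu>) \<longleftrightarrow> ?Y \<rho> \<subseteq> ?Y \<nu> \<and> card (?Y \<nu> - ?Y \<rho>) = 1"
    if "int_partition \<rho>"
    unfolding down_covers_def using is_diagram_young_diagram[OF that] by simp
  define step where "step T j \<longleftrightarrow>
        ?Y (T ! (2 * j + 1)) \<subseteq> ?Y (T ! (2 * j)) \<and>
        card (?Y (T ! (2 * j)) - ?Y (T ! (2 * j + 1))) \<in> {0, 1} \<and>
        ?Y (T ! (2 * j + 1)) \<subseteq> ?Y (T ! (2 * j + 2)) \<and>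
        card (?Y (T ! (2 * j + 2)) - ?Y (T ! (2 * j + 1))) = 1" for T :: "nat list list" and j
  have lvt: "limiting_vacillating_tableau k \<kappa> T \<longleftrightarrow>
     length T = 2 * k + 1 \<and> (\<forall>\<nu> \<in> set T. int_partition \<nu>) \<and> T ! 0 = [] \<and> T ! (2 * k) = \<kappa> \<and>
     (\<forall>j < k. step T j)" for k \<kappa> T
    by (simp only: limiting_vacillating_tableau_def step_def)
  have steps: "(\<forall>j < Suc k. step ?T j) \<longleftrightarrow> (\<forall>j < k. step S j) \<and> step ?T k"
  proof -
    have "step ?T j \<longleftrightarrow> step S j" if "j < k" for j
      using that by (simp add: step_def nth)
    then show ?thesis
      by (auto simp: less_Suc_eq)
  qed
  have step_k: "step ?T k \<longleftrightarrow> (S ! (2 * k) = \<rho> \<or> ?Y (S ! (2 * k)) \<in> up_covers (?Y \<rho>)) \<and>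
      ?Y \<rho> \<in> down_covers (?Y \<nu>)" if "int_partition \<rho>" "int_partition (S ! (2 * k))"
    unfolding step_def last nth[OF order.refl] skew[OF that(2,1), symmetric] down[OF that(1)]
    by (simp only: conj_assoc)
  have "?L \<longleftrightarrow> (\<forall>\<nu> \<in> set S. int_partition \<nu>) \<and> int_partition \<rho> \<and> int_partition \<nu> \<and>
      S ! 0 = [] \<and> \<nu> = \<mu> \<and> (\<forall>j < k. step S j) \<and> step ?T k"
    using assms last nth[of 0] by (auto simp: lvt steps)
  also have "\<dots> \<longleftrightarrow> ?R"
    unfolding lvt using assms mem step_k by auto
  finally show ?thesis .
qed

text \<open>
  A tableau of length \<open>2 * (k + 1)\<close> is the same as its penultimate entry \<open>\<rho>\<close>, the shape \<open>\<kappa>\<close> before it,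
  and a tableau of length \<open>2 * k\<close> and shape \<open>\<kappa>\<close>. This is the recursion of \<open>num_walks\<close>. Finiteness is
  part of the induction since the summation over \<open>\<rho>\<close> and \<open>\<kappa>\<close> of cardinalities depends on it.
\<close>

lemma finite_num_lvt_eq:
  "int_partition \<mu> \<Longrightarrow> finite {T. limiting_vacillating_tableau k \<mu> T} \<and>
     num_lvt k \<mu> = num_walks k (young_diagram \<mu>)"
proof (induction k arbitrary: \<mu>)
  case 0
  have "{T. limiting_vacillating_tableau 0 \<mu> T} = (if \<mu> = [] then {[[]]} else {})"
    by (auto simp: limiting_vacillating_tableau_def length_Suc_conv int_partition_def)
  moreover have "young_diagram \<mu> = {} \<longleftrightarrow> \<mu> = []"
    using 0 by (cases \<mu>) (force simp: young_diagram_def int_partition_def)+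
  ultimately show ?case
    by (simp add: num_lvt_def)
next
  case (Suc k)
  let ?Y = young_diagram
  define L where "L = {\<rho>. int_partition \<rho> \<and> ?Y \<rho> \<in> down_covers (?Y \<mu>)}"
  define U where "U \<rho> = {\<kappa>. int_partition \<kappa> \<and> ?Y \<kappa> \<in> up_covers (?Y \<rho>)}" for \<rho>
  define W where "W \<kappa> = {T. limiting_vacillating_tableau k \<kappa> T}" for \<kappa>
  define I where "I = (SIGMA \<rho>:L. SIGMA \<kappa>:insert \<rho> (U \<rho>). W \<kappa>)"
  define h where "h = (\<lambda>(\<rho>, \<kappa>::nat list, S). S @ [\<rho>, \<mu>])"
  have dY: "is_diagram (?Y \<rho>)" if "int_partition \<rho>" for \<rho>
    using is_diagram_young_diagram[OF that] .
  have down_sub: "down_covers D \<subseteq> {D. is_diagram D}" and up_sub: "up_covers D \<subseteq> {D. is_diagram D}" for D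
    by (auto simp: down_covers_def up_covers_def)
  have finL: "finite L"
    unfolding L_def by (rule sum_over_diagrams(2)[OF down_sub finite_down_covers[OF dY[OF Suc.prems]]])
  have finU: "finite (U \<rho>)" if "\<rho> \<in> L" for \<rho>
    unfolding U_def using that L_def
    by (intro sum_over_diagrams(2)[OF up_sub finite_up_covers[OF dY]]) simp
  have intU: "int_partition \<kappa>" if "\<rho> \<in> L" "\<kappa> \<in> insert \<rho> (U \<rho>)" for \<rho> \<kappa>
    using that by (auto simp: L_def U_def)
  have finW: "finite (W \<kappa>)" and cardW: "card (W \<kappa>) = num_walks k (?Y \<kappa>)" if "int_partition \<kappa>" for \<kappa>
    using Suc.IH[OF that] by (auto simp: W_def num_lvt_def)
  have "inj_on h I"
    by (rule inj_onI) (auto simp: h_def I_def W_def limiting_vacillating_tableau_def)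
  moreover have "h ` I = {T. limiting_vacillating_tableau (Suc k) \<mu> T}"
  proof (intro equalityI subsetI)
    fix T assume "T \<in> h ` I"
    then obtain \<rho> \<kappa> S where T: "T = S @ [\<rho>, \<mu>]" "\<rho> \<in> L" "\<kappa> = \<rho> \<or> \<kappa> \<in> U \<rho>"
      and S: "limiting_vacillating_tableau k \<kappa> S"
      by (auto simp: h_def I_def W_def)
    have "length S = 2 * k + 1"
      using S by (simp add: limiting_vacillating_tableau_def)
    then have "limiting_vacillating_tableau (Suc k) \<mu> T"
      using tableau_extend_iff[of S k \<mu> \<rho> \<mu>] T S Suc.prems by (auto simp: L_def U_def)
    then show "T \<in> {T. limiting_vacillating_tableau (Suc k) \<mu> T}"
      by simp
  next
    fix T assume "T \<in> {T. limiting_vacillating_tableau (Suc k) \<mu> T}"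
    then have T: "limiting_vacillating_tableau (Suc k) \<mu> T"
      by simp
    define S where "S = take (2 * k + 1) T"
    define \<rho> \<nu> where "\<rho> = T ! (2 * k + 1)" and "\<nu> = T ! (2 * k + 2)"
    have len: "length T = 2 * k + 3"
      using T by (simp add: limiting_vacillating_tableau_def)
    have S: "length S = 2 * k + 1"
      using len by (simp add: S_def)
    have "drop (2 * k + 1) T = [\<rho>, \<nu>]"
      using len by (simp add: \<rho>_def \<nu>_def Cons_nth_drop_Suc[symmetric])
    then have eq: "T = S @ [\<rho>, \<nu>]"
      unfolding S_def by (metis append_take_drop_id)
    then obtain \<kappa> where \<kappa>: "limiting_vacillating_tableau k \<kappa> S" "int_partition \<rho>" "\<nu> = \<mu>"
       "?Y \<rho> \<in> down_covers (?Y \<nu>)" "\<kappa> = \<rho> \<or> ?Y \<kappa> \<in> up_covers (?Y \<rho>)"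
      using T tableau_extend_iff[OF S, of \<mu> \<rho> \<nu>] by auto
    have "\<kappa> \<in> set S"
      using \<kappa>(1) S unfolding limiting_vacillating_tableau_def by (metis less_add_one nth_mem)
    then have "int_partition \<kappa>"
      using \<kappa>(1) unfolding limiting_vacillating_tableau_def by blast
    then have "(\<rho>, \<kappa>, S) \<in> I"
      using \<kappa> by (auto simp: I_def L_def U_def W_def)
    moreover have "T = h (\<rho>, \<kappa>, S)"
      using eq \<kappa>(3) by (simp add: h_def)
    ultimately show "T \<in> h ` I"
      by blast
  qed
  ultimately have bij: "bij_betw h I {T. limiting_vacillating_tableau (Suc k) \<mu> T}"
    by (simp add: bij_betw_def)
  have finW': "finite (SIGMA \<kappa>:insert \<rho> (U \<rho>). W \<kappa>)" if "\<rho> \<in> L" for \<rho>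
    using finU[OF that] finW intU[OF that] by (intro finite_SigmaI) auto
  have "finite I"
    unfolding I_def by (rule finite_SigmaI[OF finL finW'])
  then have "finite {T. limiting_vacillating_tableau (Suc k) \<mu> T}"
    using bij_betw_finite[OF bij] by simp
  moreover have "num_lvt (Suc k) \<mu> = num_walks (Suc k) (?Y \<mu>)"
  proof -
    have "num_lvt (Suc k) \<mu> = card I"
      unfolding num_lvt_def using bij_betw_same_card[OF bij] by simp
    also have "\<dots> = (\<Sum>\<rho>\<in>L. card (SIGMA \<kappa>:insert \<rho> (U \<rho>). W \<kappa>))"
      unfolding I_def by (rule card_SigmaI) (use finL finW' in blast)+
    also have "\<dots> = (\<Sum>\<rho>\<in>L. num_walks k (?Y \<rho>) + (\<Sum>E\<in>up_covers (?Y \<rho>). num_walks k E))"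
    proof (rule sum.cong[OF refl])
      fix \<rho> assume \<rho>: "\<rho> \<in> L"
      have "\<rho> \<notin> U \<rho>"
        by (auto simp: U_def up_covers_def)
      have "card (SIGMA \<kappa>:insert \<rho> (U \<rho>). W \<kappa>) = (\<Sum>\<kappa>\<in>insert \<rho> (U \<rho>). card (W \<kappa>))"
        using finU[OF \<rho>] finW intU[OF \<rho>] by (intro card_SigmaI) auto
      also have "\<dots> = (\<Sum>\<kappa>\<in>insert \<rho> (U \<rho>). num_walks k (?Y \<kappa>))"
        using cardW intU[OF \<rho>] by (intro sum.cong) auto
      also have "\<dots> = num_walks k (?Y \<rho>) + (\<Sum>\<kappa>\<in>U \<rho>. num_walks k (?Y \<kappa>))"
        using finU[OF \<rho>] \<open>\<rho> \<notin> U \<rho>\<close> by simp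
      also have "(\<Sum>\<kappa>\<in>U \<rho>. num_walks k (?Y \<kappa>)) = (\<Sum>E\<in>up_covers (?Y \<rho>). num_walks k E)"
        unfolding U_def by (rule sum_over_diagrams(1)[OF up_sub])
      finally show "card (SIGMA \<kappa>:insert \<rho> (U \<rho>). W \<kappa>) =
          num_walks k (?Y \<rho>) + (\<Sum>E\<in>up_covers (?Y \<rho>). num_walks k E)" .
    qed
    also have "\<dots> = num_walks (Suc k) (?Y \<mu>)"
      unfolding L_def num_walks.simps
      by (rule sum_over_diagrams(1)[OF down_sub, of "\<lambda>C. num_walks k C + (\<Sum>E\<in>up_covers C. num_walks k E)"])
    finally show ?thesis .
  qed
  ultimately show ?case
    by simp
qed

lemma num_lvt_eq_Stirling:
  assumes "int_partition \<mu>"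
  defines "D \<equiv> young_diagram \<mu>"
  shows "num_lvt k \<mu> = Stirling k (card D) * num_chains (card D) D"
  using finite_num_lvt_eq[OF assms(1)] num_walks_eq[OF is_diagram_young_diagram[OF assms(1)]]
  by (simp add: D_def)

text \<open>
  The support is finite because \<open>S(k\<^sub>1, m) = 0\<close> for \<open>m > k\<^sub>1\<close>. Grouping the partitions by size
  leaves the sum of the squared chain numbers as the inner sum.
\<close>

lemma has_sum_num_lvt_product:
  "((\<lambda>\<mu>. num_lvt k1 \<mu> * num_lvt k2 \<mu>) has_sum
     (\<Sum>m\<le>k1. Stirling k1 m * (Stirling k2 m * fact m))) {\<mu>. int_partition \<mu>}"
proof -
  let ?D = "{D. is_diagram D \<and> card D \<le> k1}"
  let ?M = "{\<mu>. int_partition \<mu> \<and> young_diagram \<mu> \<in> ?D}"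
  define F where "F D = Stirling k1 (card D) * num_chains (card D) D *
      (Stirling k2 (card D) * num_chains (card D) D)" for D
  have D_Un: "?D = (\<Union>m\<in>{..k1}. {D. is_diagram D \<and> card D = m})"
    by auto
  have finD: "finite ?D"
    unfolding D_Un using finite_diagrams_of_card by blast
  have sub: "?D \<subseteq> {D. is_diagram D}"
    by auto
  have "sum F ?D = (\<Sum>m\<le>k1. \<Sum>D | is_diagram D \<and> card D = m. F D)"
    unfolding D_Un by (rule sum.UNION_disjoint) (auto simp: finite_diagrams_of_card)
  also have "\<dots> = (\<Sum>m\<le>k1. Stirling k1 m * (Stirling k2 m * fact m))"
  proof (rule sum.cong[OF refl])
    fix m
    have "(\<Sum>D | is_diagram D \<and> card D = m. F D) =
        (\<Sum>D | is_diagram D \<and> card D = m. Stirling k1 m * (Stirling k2 m * (num_chains m D * num_chains m D)))"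
      by (rule sum.cong) (auto simp: F_def)
    then show "(\<Sum>D | is_diagram D \<and> card D = m. F D) = Stirling k1 m * (Stirling k2 m * fact m)"
      by (simp only: sum_distrib_left[symmetric] sum_num_chains_squared)
  qed
  finally have sumF: "sum F ?D = (\<Sum>m\<le>k1. Stirling k1 m * (Stirling k2 m * fact m))" .
  have eq: "num_lvt k1 \<mu> * num_lvt k2 \<mu> = F (young_diagram \<mu>)" if "int_partition \<mu>" for \<mu>
    using num_lvt_eq_Stirling[OF that] by (simp add: F_def)
  show ?thesis
  proof (rule has_sum_finite_neutralI)
    show "finite ?M"
      by (rule sum_over_diagrams(2)[OF sub finD])
    show "num_lvt k1 \<mu> * num_lvt k2 \<mu> = 0" if "\<mu> \<in> {\<mu>. int_partition \<mu>} - ?M" for \<mu>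
      using that is_diagram_young_diagram[of \<mu>] num_lvt_eq_Stirling[of \<mu> k1] by auto
    have "(\<Sum>\<mu>\<in>?M. num_lvt k1 \<mu> * num_lvt k2 \<mu>) = (\<Sum>\<mu>\<in>?M. F (young_diagram \<mu>))"
      using eq by (intro sum.cong) auto
    then show "(\<Sum>m\<le>k1. Stirling k1 m * (Stirling k2 m * fact m)) = (\<Sum>\<mu>\<in>?M. num_lvt k1 \<mu> * num_lvt k2 \<mu>)"
      using sum_over_diagrams(1)[OF sub, of F] sumF by simp
  qed auto
qed

section \<open>Counting connecting set partitions\<close>

lemma partition_on_block_unique:
  "partition_on A P \<Longrightarrow> X \<in> P \<Longrightarrow> Y \<in> P \<Longrightarrow> x \<in> X \<Longrightarrow> x \<in> Y \<Longrightarrow> X = Y"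
  unfolding partition_on_def disjoint_def by blast

text \<open>
  In a partition of \<open>insert x A\<close> the element \<open>x\<close> is either a block by itself (\<open>?new\<close> in the proof) or
  belongs to a block that still meets \<open>A\<close>, in which case it was added to one of the \<open>m\<close> blocks of a
  partition of \<open>A\<close> (\<open>?old\<close>). This is the defining recurrence of the Stirling numbers.
\<close>

lemma card_partition_on_eq_Stirling:
  "finite A \<Longrightarrow> card {P. partition_on A P \<and> card P = m} = Stirling (card A) m"
proof (induction A arbitrary: m rule: finite_induct)
  case empty
  have "{P. partition_on {} P \<and> card P = m} = (if m = 0 then {{}} else {})"
    by (auto simp: partition_on_empty)
  show ?case
    unfolding \<open>{P. partition_on {} P \<and> card P = m} = _\<close> by (cases m) simp_all
next
  case (insert x A)
  let ?part = "\<lambda>A m. {P. partition_on A P \<and> card P = m}"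
  show ?case
  proof (cases m)
    case 0
    have False if "P \<in> ?part (insert x A) 0" for P
    proof -
      have "finite P"
        using that insert.hyps finite_elements[of "insert x A" P] by auto
      then show False
        using that by (auto simp: partition_on_def)
    qed
    then have "?part (insert x A) 0 = {}"
      by blast
    then show ?thesis
      unfolding 0 by (simp only: card.empty card_insert_disjoint[OF insert.hyps] Stirling.simps)
  next
    case (Suc k)
    have finP: "finite P" if "partition_on A P" for P
      using finite_elements[OF insert.hyps(1) that] .
    have noX: "x \<notin> X" if "partition_on A P" "X \<in> P" for P X
      using that insert.hyps(2) by (auto simp: partition_on_def)
    let ?new = "\<lambda>P. insert {x} P"
    let ?old = "\<lambda>(P, X). insert (insert x X) (P - {X})"
    let ?S = "SIGMA P:?part A m. P"
    have sing: "{x} \<notin> P" if "partition_on A P" for P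
      using noX[OF that] by blast
    have new_old: "{x} \<notin> ?old (P, X)" if "partition_on A P" "X \<in> P" for P X
    proof -
      have "X \<noteq> {}"
        using that partition_onD3 by blast
      then have "insert x X \<noteq> {x}"
        using noX[OF that] by blast
      then show ?thesis
        using sing[OF that(1)] by auto
    qed
    have inj_new: "inj_on ?new (?part A k)"
    proof (rule inj_onI)
      fix P Q assume "P \<in> ?part A k" "Q \<in> ?part A k" "?new P = ?new Q"
      then show "P = Q"
        using sing insert_ident[of "{x}" P Q] by blast
    qed
    have inj_old: "inj_on ?old ?S"
    proof (rule inj_onI)
      fix p q assume p: "p \<in> ?S" and q: "q \<in> ?S" and eq: "?old p = ?old q"
      obtain P X Q Y where pq: "p = (P, X)" "q = (Q, Y)"
        by fastforce
      have P: "partition_on A P" "X \<in> P" and Q: "partition_on A Q" "Y \<in> Q"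
        using p q pq by auto
\<comment> \<open>The image determines the chosen block as the one that contains \<open>x\<close>, and the other blocks as those that avoid \<open>x\<close>.\<close>
            have blockx: "{Z \<in> ?old (P, X). x \<in> Z} = {insert x X}" if "partition_on A P" for P X
        using noX[OF that] by auto
      have restx: "{Z \<in> ?old (P, X). x \<notin> Z} = P - {X}" if "partition_on A P" for P X
        using noX[OF that] by auto
      have "insert x X = insert x Y"
        using eq blockx[OF P(1), of X] blockx[OF Q(1), of Y] pq by simp
      then have "X = Y"
        using noX[OF P] noX[OF Q] by (metis insert_ident)
      moreover have "P - {X} = Q - {Y}"
        using eq restx[OF P(1), of X] restx[OF Q(1), of Y] pq by simp
      ultimately show "p = q"
        using P(2) Q(2) pq by (metis insert_Diff)
    qed
    have "?part (insert x A) m = ?new ` ?part A k \<union> ?old ` ?S" (is "?L = ?R")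
    proof (intro equalityI subsetI)
      fix R assume "R \<in> ?L"
      then have R: "partition_on (insert x A) R" "card R = m"
        by auto
      have finR: "finite R"
        using finite_elements[OF _ R(1)] insert.hyps(1) by simp
      obtain Z where Z: "Z \<in> R" "x \<in> Z"
        using R(1) by (auto simp: partition_on_def)
      have RZ: "partition_on (insert x A - Z) (R - {Z})"
        using R(1) Z partition_on_insert[of Z "R - {Z}" "insert x A"]
        by (auto simp: insert_absorb partition_on_def disjoint_def disjnt_def)
      show "R \<in> ?R"
      proof (cases "Z = {x}")
        case True
        have "R - {Z} \<in> ?part A k"
          using RZ R(2) Z finR insert.hyps(2) Suc True by simp
        moreover have "R = ?new (R - {Z})"
          using Z True by auto
        ultimately show ?thesis
          by blast
      next
        case False
        define X where "X = Z - {x}"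
        have X: "X \<noteq> {}" "X \<subseteq> A" "insert x A - Z = A - X" "Z = insert x X"
          using False Z R(1) insert.hyps(2) by (auto simp: X_def partition_on_def)
        have dis: "disjnt X (\<Union>(R - {Z}))"
          using RZ X by (auto simp: partition_on_def disjnt_def)
        have "partition_on A (insert X (R - {Z}))"
          using RZ X dis by (simp add: partition_on_insert)
        moreover have "X \<notin> R - {Z}"
          using dis X(1) by (auto simp: disjnt_def)
        then have "card (insert X (R - {Z})) = m"
          using finR Z R(2) Suc by simp
        ultimately have "(insert X (R - {Z}), X) \<in> ?S"
          by simp
        moreover have "R = ?old (insert X (R - {Z}), X)"
          using \<open>X \<notin> R - {Z}\<close> Z X(4) by auto
        ultimately show ?thesis
          by blast
      qed
    next
      fix R assume "R \<in> ?R"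
      then consider P where "R = ?new P" "P \<in> ?part A k" | P X where "R = ?old (P, X)" "(P, X) \<in> ?S"
        by blast
      then show "R \<in> ?L"
      proof cases
        case 1
        then have P: "partition_on A P" "card P = k"
          by auto
        have "disjnt {x} (\<Union>P)"
          using P(1) insert.hyps(2) by (auto simp: partition_on_def)
        moreover have "{x} \<notin> P"
          using noX[OF P(1)] by auto
        ultimately show ?thesis
          using 1 P insert.hyps(2) finP[OF P(1)] Suc by (simp add: partition_on_insert)
      next
        case 2
        then have P: "partition_on A P" "X \<in> P" "card P = m"
          by auto
        have dis: "disjnt X (\<Union>(P - {X}))"
          using P by (auto simp: partition_on_def disjoint_def disjnt_def)
        have PX: "partition_on (A - X) (P - {X})" "X \<subseteq> A"
          using P partition_on_insert[OF dis, of A] by (auto simp: insert_absorb)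
        have "disjnt (insert x X) (\<Union>(P - {X}))"
          using dis noX[OF P(1)] by (auto simp: disjnt_def)
        moreover have "insert x A - insert x X = A - X"
          using insert.hyps(2) by auto
        moreover have "insert x X \<notin> P - {X}"
          using noX[OF P(1)] by auto
        ultimately show ?thesis
          using 2(1) P PX finP[OF P(1)] Suc by (auto simp: partition_on_insert)
      qed
    qed
    moreover have "?new ` ?part A k \<inter> ?old ` ?S = {}"
    proof -
      have new: "{x} \<in> R" if "R \<in> ?new ` ?part A k" for R
        using that by blast
      have old: "{x} \<notin> R" if "R \<in> ?old ` ?S" for R
      proof -
        obtain P X where "R = ?old (P, X)" "partition_on A P" "X \<in> P"
          using \<open>R \<in> ?old ` ?S\<close> by auto
        then show ?thesis
          using new_old[of P X] by simp
      qed
      show ?thesis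
      proof (rule equals0I)
        fix R assume R: "R \<in> ?new ` ?part A k \<inter> ?old ` ?S"
        show False
          using new[OF IntD1[OF R]] old[OF IntD2[OF R]] by (rule notE[rotated])
      qed
    qed
    moreover have fin: "finite (?part A k)" for k
      using finitely_many_partition_on[OF insert.hyps(1)] by (rule rev_finite_subset) auto
    moreover have "finite ?S"
      by (rule finite_SigmaI[OF fin]) (use finP in auto)
    ultimately have "card (?part (insert x A) m) = card (?part A k) + card ?S"
      using inj_new inj_old by (simp add: card_Un_disjoint card_image)
    also have "card ?S = (\<Sum>P\<in>?part A m. card P)"
      by (rule card_SigmaI[OF fin]) (use finP in auto)
    also have "\<dots> = m * card (?part A m)"
      by simp
    finally show ?thesis
      using insert Suc by simp
  qed
qed

text \<open>
  The functions are extensional, that is \<open>undefined\<close> outside \<open>B\<close>, so that they are determined by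
  their values on \<open>B\<close> and can be counted.
\<close>

definition surjections :: "'a set \<Rightarrow> 'b set \<Rightarrow> ('a \<Rightarrow> 'b) set" where
  "surjections B M = {f \<in> B \<rightarrow>\<^sub>E M. f ` B = M}"

lemma finite_surjections: "finite B \<Longrightarrow> finite M \<Longrightarrow> finite (surjections B M)"
  unfolding surjections_def by (simp add: finite_PiE)

text \<open>
  After removing \<open>x\<close>, with value \<open>y\<close>, a surjection is still onto \<open>M\<close>, or it misses exactly \<open>y\<close>.
\<close>

lemma surjections_insert:
  assumes "x \<notin> B"
  shows "surjections (insert x B) M =
    (\<lambda>(y, g). g(x := y)) ` (SIGMA y:M. surjections B M \<union> surjections B (M - {y}))"
proof (intro equalityI subsetI)
  fix f assume "f \<in> surjections (insert x B) M"
  then have f: "f \<in> insert x B \<rightarrow>\<^sub>E M" "insert (f x) (f ` B) = M"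
    by (auto simp: surjections_def)
  then obtain y g where yg: "f = g(x := y)" "y \<in> M" "g \<in> B \<rightarrow>\<^sub>E M"
    unfolding PiE_insert_eq by auto
  have "f ` B = g ` B"
    using yg(1) assms by (intro image_cong) auto
  then have "insert y (g ` B) = M"
    using f(2) yg(1) by simp
  then have "g ` B = M \<or> g ` B = M - {y}"
    by auto
  moreover have "g \<in> B \<rightarrow>\<^sub>E g ` B"
    using yg(3) by (auto simp: PiE_def)
  ultimately have "g \<in> surjections B M \<union> surjections B (M - {y})"
    by (auto simp: surjections_def)
  then show "f \<in> (\<lambda>(y, g). g(x := y)) ` (SIGMA y:M. surjections B M \<union> surjections B (M - {y}))"
    using yg by auto
next
  fix f assume "f \<in> (\<lambda>(y, g). g(x := y)) ` (SIGMA y:M. surjections B M \<union> surjections B (M - {y}))"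
  then obtain y g where yg: "f = g(x := y)" "y \<in> M" "g \<in> surjections B M \<union> surjections B (M - {y})"
    by auto
  have g: "g \<in> B \<rightarrow>\<^sub>E M" "insert y (g ` B) = M"
    using yg(2,3) by (auto simp: surjections_def PiE_def)
  have "f ` B = g ` B"
    using yg(1) assms by (intro image_cong) auto
  moreover have "f \<in> insert x B \<rightarrow>\<^sub>E M"
    unfolding PiE_insert_eq using yg g(1) by auto
  ultimately show "f \<in> surjections (insert x B) M"
    using g(2) yg(1) by (simp add: surjections_def)
qed

lemma card_surjections:
  "finite B \<Longrightarrow> finite M \<Longrightarrow> card (surjections B M) = fact (card M) * Stirling (card B) (card M)"
proof (induction B arbitrary: M rule: finite_induct)
  case empty
  have "surjections ({} :: 'a set) M = (if M = {} then {\<lambda>_. undefined} else {})"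
    by (auto simp: surjections_def)
  then show ?case
    using empty by (cases "card M") auto
next
  case (insert x B)
  have "inj_on (\<lambda>(y, g). g(x := y)) (SIGMA y:M. surjections B M \<union> surjections B (M - {y}))"
    by (rule inj_on_subset[OF inj_combinator[OF insert.hyps(2), of "\<lambda>_. M"]])
       (auto simp: surjections_def PiE_def)
  then have "card (surjections (insert x B) M) =
      card (SIGMA y:M. surjections B M \<union> surjections B (M - {y}))"
    by (simp add: surjections_insert[OF insert.hyps(2)] card_image)
  also have "\<dots> = (\<Sum>y\<in>M. card (surjections B M \<union> surjections B (M - {y})))"
    by (rule card_SigmaI) (use insert finite_surjections in auto)
  also have "\<dots> = (\<Sum>y\<in>M. fact (card M) * Stirling (card B) (card M) +
      fact (card M - 1) * Stirling (card B) (card M - 1))"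
  proof (rule sum.cong[OF refl])
    fix y assume "y \<in> M"
    then have "surjections B M \<inter> surjections B (M - {y}) = {}"
      by (auto simp: surjections_def)
    then show "card (surjections B M \<union> surjections B (M - {y})) = fact (card M) * Stirling (card B) (card M) +
      fact (card M - 1) * Stirling (card B) (card M - 1)"
      using insert \<open>y \<in> M\<close> by (simp add: card_Un_disjoint finite_surjections)
  qed
  also have "\<dots> = fact (card M) * Stirling (card (insert x B)) (card M)"
    using insert.hyps by (cases "card M") (simp_all add: algebra_simps)
  finally show ?case .
qed

text \<open>
  A surjection from \<open>B\<close> onto the blocks of a partition of \<open>A\<close> enlarges each block by its fibre;
  surjectivity says that every enlarged block meets \<open>B\<close>. Conversely, a partition in which all blocks
  meet both parts is recovered from its traces on \<open>A\<close>, together with the map that sends an element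
  of \<open>B\<close> to the trace of its block (\<open>split\<close> in the proof). Distinct blocks have distinct traces
  because the traces are nonempty and disjoint.
\<close>

lemma bij_betw_glue_blocks:
  fixes A B :: "'a set"
  assumes AB: "A \<inter> B = {}"
  shows "bij_betw (\<lambda>(Q, g). (\<lambda>X. X \<union> {b \<in> B. g b = X}) ` Q)
    (SIGMA Q:{Q. partition_on A Q}. surjections B Q)
    {P. partition_on (A \<union> B) P \<and> (\<forall>X\<in>P. X \<inter> A \<noteq> {} \<and> X \<inter> B \<noteq> {})}"
proof -
  define h :: "'a set set \<times> ('a \<Rightarrow> 'a set) \<Rightarrow> 'a set set"
    where "h = (\<lambda>(Q, g). (\<lambda>X. X \<union> {b \<in> B. g b = X}) ` Q)"
  define split :: "'a set set \<Rightarrow> 'a set set \<times> ('a \<Rightarrow> 'a set)"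
    where "split P = ((\<inter>) A ` P, \<lambda>b\<in>B. A \<inter> \<Union>{X \<in> P. b \<in> X})" for P
  define src where "src = (SIGMA Q:{Q. partition_on A Q}. surjections B Q)"
  define tgt where "tgt = {P. partition_on (A \<union> B) P \<and> (\<forall>X\<in>P. X \<inter> A \<noteq> {} \<and> X \<inter> B \<noteq> {})}"
  have glue: "h (Q, g) \<in> tgt \<and> split (h (Q, g)) = (Q, g)" if "(Q, g) \<in> src" for Q g
  proof -
    have Q: "partition_on A Q" and g: "g \<in> B \<rightarrow>\<^sub>E Q" "g ` B = Q"
      using that by (auto simp: src_def surjections_def)
    define c where "c X = X \<union> {b \<in> B. g b = X}" for X
    have hQ: "h (Q, g) = c ` Q"
      by (simp add: h_def c_def)
    have sub: "X \<subseteq> A" "X \<noteq> {}" if "X \<in> Q" for X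
      using Q that by (auto simp: partition_on_def)
    have cA: "A \<inter> c X = X" if "X \<in> Q" for X
      using sub[OF that] AB by (auto simp: c_def)
    have cB: "b \<in> c X \<longleftrightarrow> g b = X" if "X \<in> Q" "b \<in> B" for X b
      using sub[OF that(1)] AB that(2) by (auto simp: c_def)
    have gQ: "g b \<in> Q" if "b \<in> B" for b
      using g(2) that by auto
    have "partition_on (A \<union> B) (c ` Q)"
    proof (rule partition_onI)
      show "\<Union>(c ` Q) = A \<union> B"
      proof (intro equalityI subsetI)
        fix y assume "y \<in> A \<union> B"
        then show "y \<in> \<Union>(c ` Q)"
          using partition_onD1[OF Q] gQ cB by (auto simp: c_def)
      qed (use sub in \<open>auto simp: c_def\<close>)
      show "{} \<notin> c ` Q"
        using sub by (auto simp: c_def)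
      fix p q assume "p \<in> c ` Q" "q \<in> c ` Q" "p \<noteq> q"
      then obtain X Y where XY: "p = c X" "q = c Y" "X \<in> Q" "Y \<in> Q" "X \<noteq> Y"
        by blast
      have "X \<inter> Y = {}"
        using Q XY by (auto simp: partition_on_def disjoint_def)
      then show "disjnt p q"
        using XY(5) sub(1)[OF XY(3)] sub(1)[OF XY(4)] AB
        unfolding XY(1,2) c_def disjnt_def by blast
    qed
    moreover have "c X \<inter> A \<noteq> {} \<and> c X \<inter> B \<noteq> {}" if X: "X \<in> Q" for X
    proof -
      obtain b where "b \<in> B" "g b = X"
        using g(2) X by auto
      then show ?thesis
        using sub[OF X] by (auto simp: c_def)
    qed
    ultimately have "h (Q, g) \<in> tgt"
      unfolding hQ tgt_def by blast
    moreover have "(\<inter>) A ` (c ` Q) = Q"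
      using cA by (simp add: image_image)
    moreover have "(\<lambda>b\<in>B. A \<inter> \<Union>{X \<in> c ` Q. b \<in> X}) = g"
    proof (rule extensionalityI)
      show "g \<in> extensional B"
        using g(1) by (simp add: PiE_def)
      fix b assume b: "b \<in> B"
      have "{X \<in> c ` Q. b \<in> X} = {c (g b)}"
        using cB[OF _ b] gQ[OF b] by auto
      then show "(\<lambda>b\<in>B. A \<inter> \<Union>{X \<in> c ` Q. b \<in> X}) b = g b"
        using b cA[OF gQ[OF b]] by simp
    qed auto
    ultimately show ?thesis
      by (simp add: split_def hQ)
  qed
  have unglue: "split P \<in> src \<and> h (split P) = P" if "P \<in> tgt" for P
  proof -
    have P: "partition_on (A \<union> B) P" and meet: "\<And>X. X \<in> P \<Longrightarrow> A \<inter> X \<noteq> {} \<and> B \<inter> X \<noteq> {}"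
      using that by (auto simp: tgt_def)
    define g where "g = (\<lambda>b\<in>B. A \<inter> \<Union>{X \<in> P. b \<in> X})"
    have block: "{Y \<in> P. b \<in> Y} = {X}" if "X \<in> P" "b \<in> X" for X b
      using partition_on_block_unique[OF P] that by blast
    have g_eq: "g b = A \<inter> X" if "X \<in> P" "b \<in> X" "b \<in> B" for X b
      using block[OF that(1,2)] that(3) by (simp add: g_def)
    have ex: "\<exists>X\<in>P. b \<in> X" if "b \<in> B" for b
      using P that by (auto simp: partition_on_def)
    have "(\<inter>) A ` P - {{}} = (\<inter>) A ` P"
      using meet by blast
    then have part: "partition_on A ((\<inter>) A ` P)"
      using partition_on_restrict[OF P, of A] by (simp add: Int_absorb2)
    have "g ` B = (\<inter>) A ` P"
    proof (intro equalityI subsetI)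
      fix Y assume "Y \<in> g ` B"
      then show "Y \<in> (\<inter>) A ` P"
        using ex g_eq by fastforce
    next
      fix Y assume "Y \<in> (\<inter>) A ` P"
      then obtain X where X: "X \<in> P" "Y = A \<inter> X"
        by blast
      then obtain b where "b \<in> B" "b \<in> X"
        using meet by blast
      then show "Y \<in> g ` B"
        using g_eq[OF X(1)] X(2) by blast
    qed
    moreover have "g \<in> extensional B"
      by (simp add: g_def)
    ultimately have "g \<in> surjections B ((\<inter>) A ` P)"
      by (auto simp: surjections_def PiE_def)
    then have "split P \<in> src"
      using part by (simp add: split_def src_def g_def)
    moreover have "(A \<inter> X) \<union> {b \<in> B. g b = A \<inter> X} = X" if X: "X \<in> P" for X
    proof -
      have "b \<in> X" if b: "b \<in> B" "g b = A \<inter> X" for b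
      proof -
        obtain Y where Y: "Y \<in> P" "b \<in> Y"
          using ex[OF b(1)] by blast
        then have "A \<inter> Y = A \<inter> X"
          using g_eq[OF Y b(1)] b(2) by simp
        then have "Y = X"
          using meet[OF X] partition_on_block_unique[OF P Y(1) X] by blast
        then show ?thesis
          using Y by simp
      qed
      moreover have "X \<subseteq> A \<union> B"
        using P X by (auto simp: partition_on_def)
      ultimately show ?thesis
        using g_eq[OF X] by blast
    qed
    then have "h (split P) = P"
      by (simp add: h_def split_def image_image g_def[symmetric])
    ultimately show ?thesis
      by blast
  qed
  have "bij_betw h src tgt"
    by (rule bij_betw_byWitness[where f' = split]) (use glue unglue in auto)
  then show ?thesis
    by (simp only: h_def src_def tgt_def)
qed

lemma card_meeting_partitions:
  assumes "finite A" "finite B" "A \<inter> B = {}"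
  shows "card {P. partition_on (A \<union> B) P \<and> (\<forall>X\<in>P. X \<inter> A \<noteq> {} \<and> X \<inter> B \<noteq> {})} =
    (\<Sum>m\<le>card A. Stirling (card A) m * (Stirling (card B) m * fact m))"
proof -
  let ?w = "\<lambda>m. Stirling (card B) m * fact m"
  have fin: "finite {Q. partition_on A Q}"
    by (rule finitely_many_partition_on[OF assms(1)])
  have finQ: "finite Q" if "partition_on A Q" for Q
    using finite_elements[OF assms(1) that] .
  have "card {P. partition_on (A \<union> B) P \<and> (\<forall>X\<in>P. X \<inter> A \<noteq> {} \<and> X \<inter> B \<noteq> {})}
      = card (SIGMA Q:{Q. partition_on A Q}. surjections B Q)"
    using bij_betw_same_card[OF bij_betw_glue_blocks[OF assms(3)]] by simp
  also have "\<dots> = (\<Sum>Q | partition_on A Q. card (surjections B Q))"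
    by (rule card_SigmaI[OF fin]) (use assms finQ finite_surjections in auto)
  also have "\<dots> = (\<Sum>Q | partition_on A Q. ?w (card Q))"
    by (intro sum.cong) (simp_all add: card_surjections[OF assms(2)] finQ)
  also have "\<dots> = (\<Sum>m\<le>card A. \<Sum>Q | Q \<in> {Q. partition_on A Q} \<and> card Q = m. ?w (card Q))"
  proof (rule sum.group[symmetric, OF fin])
    have "card Q \<le> card A" if "partition_on A Q" for Q
    proof (rule ccontr)
      assume "\<not> card Q \<le> card A"
      then have "card {P. partition_on A P \<and> card P = card Q} = 0"
        using card_partition_on_eq_Stirling[OF assms(1), of "card Q"] by simp
      moreover have "finite {P. partition_on A P \<and> card P = card Q}"
        using fin by (rule rev_finite_subset) auto
      ultimately show False
        using that by auto
    qed
    then show "card ` {Q. partition_on A Q} \<subseteq> {..card A}"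
      by auto
  qed simp
  also have "\<dots> = (\<Sum>m\<le>card A. Stirling (card A) m * ?w m)"
    using card_partition_on_eq_Stirling[OF assms(1)] by (intro sum.cong) simp_all
  finally show ?thesis .
qed

theorem theorem14:
  fixes k1 k2 :: nat
  assumes "k1 \<ge> 1" and "k2 \<ge> 1"
  shows "((\<lambda>\<mu>. num_lvt k1 \<mu> * num_lvt k2 \<mu>) has_sum
           card {P. connecting_partition k1 k2 P}) {\<mu>. int_partition \<mu>}"
proof -
  let ?A = "{1..k1}" and ?B = "{k1 + 1..k1 + k2}"
  have AB: "?A \<union> ?B = {1..k1 + k2}"
    by auto
  have "Min X \<le> k1 \<and> k1 < Max X \<longleftrightarrow> X \<inter> ?A \<noteq> {} \<and> X \<inter> ?B \<noteq> {}"
    if "partition_on {1..k1 + k2} P" "X \<in> P" for P X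
  proof -
    have X: "X \<subseteq> {1..k1 + k2}" "X \<noteq> {}"
      using that by (auto simp: partition_on_def)
    then have "finite X"
      using finite_subset by blast
    then have "Min X \<le> k1 \<longleftrightarrow> (\<exists>x\<in>X. x \<le> k1)" "k1 < Max X \<longleftrightarrow> (\<exists>x\<in>X. k1 < x)"
      using X(2) by (simp_all add: Min_le_iff Max_gr_iff)
    then show ?thesis
      using X(1) by fastforce
  qed
  then have "{P. connecting_partition k1 k2 P} =
      {P. partition_on (?A \<union> ?B) P \<and> (\<forall>X\<in>P. X \<inter> ?A \<noteq> {} \<and> X \<inter> ?B \<noteq> {})}"
    unfolding connecting_partition_def AB by blast
  then have "card {P. connecting_partition k1 k2 P} =
      (\<Sum>m\<le>k1. Stirling k1 m * (Stirling k2 m * fact m))"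
    using card_meeting_partitions[of ?A ?B] by simp
  then show ?thesis
    using has_sum_num_lvt_product[of k1 k2] by simp
qed

end
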